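(* Let $\operatorname{Aut}(\mathbb{R})$ be the group of maps $x\mapsto x+b$ and $x\mapsto -x+b$ ($b\in\mathbb{R}$) acting on $\mathbb{R}$. Then $\operatorname{ext}_D(\mathbb{R})=4$.
   Context: For a group $\Gamma$ acting on a set $X$, a $k$-coloring $\phi:X\to\{1,\dots,k\}$ is distinguishing if the only $\gamma\in\Gamma$ with $\phi(\gamma(x))=\phi(x)$ for all $x\in X$ is the identity. The distinguishing number $D_\Gamma(X)$ is the least $k$ admitting a distinguishing $k$-coloring. A set $S\subseteq X$ is a fixing set if for every non-identity $\gamma\in\Gamma$ there is $s\in S$ with $\gamma(s)\ne s$. The distinguishing extension number $\operatorname{ext}_D(X,\Gamma;k)$ is the minimum $m$ such that for every fixing set $W\subseteq X$ with $|W|\ge m$, every coloring $c:X\setminus W\to\{1,\dots,k\}$ extends to a $k$-coloring of $X$ that is distinguishing under $\Gamma$; and $\operatorname{ext}_D(X)=\operatorname{ext}_D(X,\Gamma;D_\Gamma(X))$. Here $D_{\operatorname{Aut}(\mathbb{R})}(\mathbb{R})=2$. *)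

theory Defs
  imports Complex_Main "HOL-Algebra.Group_Action"
begin

text \<open>
  An action of a group \<open>G\<close> on a set \<open>X\<close> is given, as in the locale \<open>group_action\<close>, by a map
  \<open>\<phi>\<close> sending each element of \<open>carrier G\<close> to a permutation of \<open>X\<close>.  A colouring of \<open>X\<close> with \<open>k\<close>
  colours is an element of \<open>X \<rightarrow> {1..k}\<close>; its values outside \<open>X\<close> are irrelevant.
\<close>

definition distinguishing ::
  "('g, 'm) monoid_scheme \<Rightarrow> 'x set \<Rightarrow> ('g \<Rightarrow> 'x \<Rightarrow> 'x) \<Rightarrow> ('x \<Rightarrow> nat) \<Rightarrow> bool" where
  "distinguishing G X \<phi> c \<longleftrightarrow>
     (\<forall>g \<in> carrier G. (\<forall>x \<in> X. c (\<phi> g x) = c x) \<longrightarrow> g = \<one>\<^bsub>G\<^esub>)"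

definition distinguishing_number ::
  "('g, 'm) monoid_scheme \<Rightarrow> 'x set \<Rightarrow> ('g \<Rightarrow> 'x \<Rightarrow> 'x) \<Rightarrow> nat" where
  "distinguishing_number G X \<phi> = (LEAST k. \<exists>c \<in> X \<rightarrow> {1..k}. distinguishing G X \<phi> c)"

definition fixing_set ::
  "('g, 'm) monoid_scheme \<Rightarrow> 'x set \<Rightarrow> ('g \<Rightarrow> 'x \<Rightarrow> 'x) \<Rightarrow> 'x set \<Rightarrow> bool" where
  "fixing_set G X \<phi> S \<longleftrightarrow>
     S \<subseteq> X \<and> (\<forall>g \<in> carrier G. g \<noteq> \<one>\<^bsub>G\<^esub> \<longrightarrow> (\<exists>s \<in> S. \<phi> g s \<noteq> s))"

text \<open>
  Fixing sets may be infinite.  Since \<open>card\<close> is \<open>0\<close> on infinite sets, the condition that \<open>W\<close> has at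
  least \<open>m\<close> elements is written \<open>infinite W \<or> m \<le> card W\<close>.
\<close>

definition ext_D_k ::
  "('g, 'm) monoid_scheme \<Rightarrow> 'x set \<Rightarrow> ('g \<Rightarrow> 'x \<Rightarrow> 'x) \<Rightarrow> nat \<Rightarrow> nat" where
  "ext_D_k G X \<phi> k =
     (LEAST m. \<forall>W. fixing_set G X \<phi> W \<and> (infinite W \<or> m \<le> card W) \<longrightarrow>
        (\<forall>c \<in> (X - W) \<rightarrow> {1..k}.
           \<exists>c' \<in> X \<rightarrow> {1..k}. (\<forall>x \<in> X - W. c' x = c x) \<and> distinguishing G X \<phi> c'))"

definition ext_D ::
  "('g, 'm) monoid_scheme \<Rightarrow> 'x set \<Rightarrow> ('g \<Rightarrow> 'x \<Rightarrow> 'x) \<Rightarrow> nat" where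
  "ext_D G X \<phi> = ext_D_k G X \<phi> (distinguishing_number G X \<phi>)"

definition Aut_real :: "(real \<Rightarrow> real) monoid" where
  "Aut_real =
     \<lparr>carrier = {f. \<exists>b. f = (\<lambda>x. x + b) \<or> f = (\<lambda>x. - x + b)}, mult = (\<circ>), one = id\<rparr>"

text \<open>The elements of \<open>Aut_real\<close> are themselves maps, so the action is evaluation.\<close>

lemma Aut_real_group: "group Aut_real"
proof (rule groupI)
  fix f g assume "f \<in> carrier Aut_real" "g \<in> carrier Aut_real"
  then obtain b c where
    "f = (\<lambda>x. x + b) \<or> f = (\<lambda>x. - x + b)" "g = (\<lambda>x. x + c) \<or> g = (\<lambda>x. - x + c)"
    by (auto simp: Aut_real_def)
  then have "f \<circ> g = (\<lambda>x. x + (c + b)) \<or> f \<circ> g = (\<lambda>x. - x + (c + b))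
      \<or> f \<circ> g = (\<lambda>x. - x + (b - c)) \<or> f \<circ> g = (\<lambda>x. x + (b - c))"
    by (auto simp: fun_eq_iff)
  then show "f \<otimes>\<^bsub>Aut_real\<^esub> g \<in> carrier Aut_real"
    unfolding Aut_real_def by auto
next
  show "\<one>\<^bsub>Aut_real\<^esub> \<in> carrier Aut_real"
    by (auto simp: Aut_real_def fun_eq_iff intro!: exI[of _ 0])
next
  fix f assume "f \<in> carrier Aut_real"
  then obtain b where b: "f = (\<lambda>x. x + b) \<or> f = (\<lambda>x. - x + b)"
    by (auto simp: Aut_real_def)
  show "\<exists>g \<in> carrier Aut_real. g \<otimes>\<^bsub>Aut_real\<^esub> f = \<one>\<^bsub>Aut_real\<^esub>"
    using b
  proof
    assume "f = (\<lambda>x. x + b)"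
    then show ?thesis
      by (intro bexI[of _ "\<lambda>x. x + (- b)"]) (auto simp: Aut_real_def fun_eq_iff)
  next
    assume "f = (\<lambda>x. - x + b)"
    then show ?thesis
      by (intro bexI[of _ "\<lambda>x. - x + b"]) (auto simp: Aut_real_def fun_eq_iff)
  qed
qed (auto simp: Aut_real_def comp_assoc)

lemma Aut_real_action: "group_action Aut_real UNIV (\<lambda>f. f)"
proof -
  have bij: "bij f" if f: "f \<in> carrier Aut_real" for f
  proof -
    obtain b where "f = (\<lambda>x. x + b) \<or> f = (\<lambda>x. - x + b)"
      using f by (auto simp: Aut_real_def)
    then show ?thesis
    proof
      assume "f = (\<lambda>x. x + b)"
      then show ?thesis by (intro o_bij[of "\<lambda>x. x - b"]) (auto simp: fun_eq_iff)
    next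
      assume "f = (\<lambda>x. - x + b)"
      then show ?thesis by (intro o_bij[of "\<lambda>x. - x + b"]) (auto simp: fun_eq_iff)
    qed
  qed
  then have "(\<lambda>f. f) \<in> hom Aut_real (BijGroup UNIV)"
    by (auto simp: hom_def BijGroup_def Bij_def compose_def Aut_real_def fun_eq_iff)
  then show ?thesis
    by (simp add: group_action_def group_hom_def group_hom_axioms_def Aut_real_group group_BijGroup)
qed

end

theory Submission
  imports Defs
begin

text \<open>
  The fixing set \<open>{0, 1, 2}\<close> with a constant colouring outside shows that three points do not
  suffice: every subset of it has a mirror symmetry.

  For the converse, let \<open>f\<close> colour four points of \<open>W\<close> by \<open>1\<close> and write \<open>\<delta>\<^sub>w\<close> for the indicator of
  \<open>w\<close>.  A periodic function plus a finitely supported function \<open>h\<close> has no symmetry unless \<open>h\<close> is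
  mirror symmetric.  If no extension is distinguishing, then \<open>f\<close> and all \<open>f + \<delta>\<^sub>w\<close> are
  therefore not periodic, and so they have mirror symmetries, about \<open>p\<close> and \<open>q\<^sub>w\<close>.  For \<open>w \<noteq> p\<close>,
  composing the two mirrors gives
  \<open>f (x + t) - f x = \<delta>\<^sub>w x - \<delta>\<^sub>a x\<close> with \<open>t = 2 (p - q\<^sub>w)\<close> and \<open>a = 2 q\<^sub>w - w\<close>.
  Commuting these difference equations for two points \<open>w, w'\<close> that are not mirror images about
  \<open>p\<close> forces \<open>t = p - w\<close> and \<open>a = p\<close>, so \<open>f - \<delta>\<^sub>p\<close> is periodic.  Three of the four points
  differ from \<open>p\<close>, and two of them, \<open>v\<close> and \<open>w\<close>, do not form a three-term progression with \<open>p\<close>;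
  then \<open>f + \<delta>\<^sub>v + \<delta>\<^sub>w\<close> is distinguishing after all.
\<close>

definition translation_invariant :: "(real \<Rightarrow> 'a) \<Rightarrow> real \<Rightarrow> bool" where
  "translation_invariant f t \<longleftrightarrow> (\<forall>x. f (x + t) = f x)"

definition mirror_invariant :: "(real \<Rightarrow> 'a) \<Rightarrow> real \<Rightarrow> bool" where
  "mirror_invariant f p \<longleftrightarrow> (\<forall>x. f (2 * p - x) = f x)"

definition asymmetric :: "(real \<Rightarrow> 'a) \<Rightarrow> bool" where
  "asymmetric f \<longleftrightarrow>
     (\<forall>t. translation_invariant f t \<longrightarrow> t = 0) \<and> (\<forall>p. \<not> mirror_invariant f p)"

definition delta :: "real \<Rightarrow> real \<Rightarrow> int" where
  "delta a x = (if x = a then 1 else 0)"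

text \<open>For distinct points this says that \<open>{a, b, c}\<close> has a mirror: a reflection
  preserving three points fixes one of them and swaps the other two.\<close>

definition progression3 :: "real \<Rightarrow> real \<Rightarrow> real \<Rightarrow> bool" where
  "progression3 a b c \<longleftrightarrow> a + b = 2 * c \<or> a + c = 2 * b \<or> b + c = 2 * a"

section \<open>Isometries of the line as translations and mirrors\<close>

text \<open>The reflection \<open>- x + b\<close> is written through its centre
  \<open>p = b / 2\<close>.\<close>

lemma ball_Aut_real:
  "(\<forall>g \<in> carrier Aut_real. P g) \<longleftrightarrow> (\<forall>t. P (\<lambda>x. x + t)) \<and> (\<forall>p. P (\<lambda>x. 2 * p - x))"
proof -
  have "carrier Aut_real = range (\<lambda>t x. x + t) \<union> range (\<lambda>b x. - x + b)"
    unfolding Aut_real_def by auto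
  moreover have "range (\<lambda>b x. - x + b) = range (\<lambda>p x. 2 * p - (x::real))"
  proof (intro equalityI image_subsetI)
    fix b :: real
    have "(\<lambda>x. - x + b) = (\<lambda>x. 2 * (b / 2) - x)"
      by auto
    then show "(\<lambda>x. - x + b) \<in> range (\<lambda>p x. 2 * p - x)"
      by (rule range_eqI)
  next
    fix p :: real
    have "(\<lambda>x. 2 * p - x) = (\<lambda>x. - x + 2 * p)"
      by auto
    then show "(\<lambda>x. 2 * p - x) \<in> range (\<lambda>b x. - x + b)"
      by (rule range_eqI)
  qed
  ultimately show ?thesis
    by auto
qed

lemma one_Aut_real: "\<one>\<^bsub>Aut_real\<^esub> = id"
  by (simp add: Aut_real_def)

lemma translation_eq_id_iff: "(\<lambda>x::real. x + t) = id \<longleftrightarrow> t = 0"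
  by (auto simp: fun_eq_iff)

lemma reflection_neq_id: "(\<lambda>x::real. 2 * p - x) \<noteq> id"
proof
  assume "(\<lambda>x::real. 2 * p - x) = id"
  then have "2 * p - (p + 1) = p + 1"
    by (metis id_apply)
  then show False by simp
qed

lemma distinguishing_Aut_real_iff:
  "distinguishing Aut_real UNIV (\<lambda>f. f) c \<longleftrightarrow> asymmetric c"
  by (simp add: distinguishing_def ball_Aut_real one_Aut_real translation_eq_id_iff
      reflection_neq_id asymmetric_def translation_invariant_def mirror_invariant_def)

lemma fixing_set_Aut_real:
  assumes "a \<in> W" "b \<in> W" "a \<noteq> b"
  shows "fixing_set Aut_real UNIV (\<lambda>f. f) W"
  unfolding fixing_set_def ball_Aut_real one_Aut_real
proof (intro conjI allI impI)
  fix p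
  have "2 * p - a \<noteq> a \<or> 2 * p - b \<noteq> b"
    using assms by auto
  then show "\<exists>s\<in>W. 2 * p - s \<noteq> s"
    using assms by blast
qed (use assms in \<open>auto simp: translation_eq_id_iff\<close>)

section \<open>Finite perturbations of periodic functions\<close>

text \<open>A nonzero value would recur along the infinite progression
  \<open>x + n * t\<close>.\<close>

lemma finite_support_translation_invariant:
  fixes h :: "real \<Rightarrow> int"
  assumes "finite {x. h x \<noteq> 0}" and "translation_invariant h t" and "t \<noteq> 0"
  shows "h x = 0"
proof (rule ccontr)
  assume "h x \<noteq> 0"
  have "h (x + real n * t) = h x" for n
  proof (induction n)
    case (Suc n)
    have "h (x + real (Suc n) * t) = h ((x + real n * t) + t)"
      by (simp add: algebra_simps)
    with Suc assms(2) show ?case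
      by (simp add: translation_invariant_def)
  qed simp
  with \<open>h x \<noteq> 0\<close> have "range (\<lambda>n. x + real n * t) \<subseteq> {x. h x \<noteq> 0}"
    by auto
  moreover have "inj (\<lambda>n. x + real n * t)"
    using \<open>t \<noteq> 0\<close> by (auto simp: inj_def)
  ultimately show False
    using assms(1) finite_subset finite_imageD infinite_UNIV_nat by blast
qed

text \<open>For a symmetry \<sigma> of \<open>g + h\<close>, the function h \<circ> \<sigma> - h
  equals g - g \<circ> \<sigma>. It has finite support and period \<open>s\<close>, so it vanishes
  and \<sigma> is already a symmetry of \<open>h\<close>.\<close>

lemma asymmetric_periodic_plus_finite:
  fixes g h :: "real \<Rightarrow> int"
  assumes g: "translation_invariant g s" "s \<noteq> 0"
    and fin: "finite {x. h x \<noteq> 0}" and nosym: "\<And>p. \<not> mirror_invariant h p"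
  shows "asymmetric (\<lambda>x. g x + h x)"
  unfolding asymmetric_def
proof (intro conjI allI impI notI)
  fix t assume inv: "translation_invariant (\<lambda>x. g x + h x) t"
  show "t = 0"
  proof (rule ccontr)
    assume "t \<noteq> 0"
    have diff: "h (x + t) - h x = g x - g (x + t)" for x
      using inv[unfolded translation_invariant_def, rule_format, of x] by linarith
    have "finite ((\<lambda>x. x - t) ` {x. h x \<noteq> 0} \<union> {x. h x \<noteq> 0})"
      using fin by simp
    moreover have "{x. h (x + t) - h x \<noteq> 0} \<subseteq> (\<lambda>x. x - t) ` {x. h x \<noteq> 0} \<union> {x. h x \<noteq> 0}"
    proof
      fix x assume "x \<in> {x. h (x + t) - h x \<noteq> 0}"
      then have "h (x + t) \<noteq> 0 \<or> h x \<noteq> 0" and "x = (x + t) - t"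
        by auto
      then show "x \<in> (\<lambda>x. x - t) ` {x. h x \<noteq> 0} \<union> {x. h x \<noteq> 0}"
        by blast
    qed
    ultimately have "finite {x. h (x + t) - h x \<noteq> 0}"
      by (rule rev_finite_subset)
    moreover have "translation_invariant (\<lambda>x. h (x + t) - h x) s"
      using g(1) unfolding diff translation_invariant_def
      by (metis add.assoc add.commute)
    ultimately have "h (x + t) - h x = 0" for x
      using finite_support_translation_invariant[OF _ _ g(2)] by fastforce
    then have "translation_invariant h t"
      by (simp add: translation_invariant_def)
    then have "h x = 0" for x
      using finite_support_translation_invariant fin \<open>t \<noteq> 0\<close> by blast
    \<comment> \<open>The zero function has every mirror.\<close>
    then show False
      using nosym[of 0] by (simp add: mirror_invariant_def)
  qed
next
  fix p assume inv: "mirror_invariant (\<lambda>x. g x + h x) p"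
  have diff: "h (2 * p - x) - h x = g x - g (2 * p - x)" for x
    using inv[unfolded mirror_invariant_def, rule_format, of x] by linarith
  have "finite ((\<lambda>x. 2 * p - x) ` {x. h x \<noteq> 0} \<union> {x. h x \<noteq> 0})"
    using fin by simp
  moreover have "{x. h (2 * p - x) - h x \<noteq> 0} \<subseteq> (\<lambda>x. 2 * p - x) ` {x. h x \<noteq> 0} \<union> {x. h x \<noteq> 0}"
  proof
    fix x assume "x \<in> {x. h (2 * p - x) - h x \<noteq> 0}"
    then have "h (2 * p - x) \<noteq> 0 \<or> h x \<noteq> 0" and "x = 2 * p - (2 * p - x)"
      by auto
    then show "x \<in> (\<lambda>x. 2 * p - x) ` {x. h x \<noteq> 0} \<union> {x. h x \<noteq> 0}"
      by blast
  qed
  ultimately have "finite {x. h (2 * p - x) - h x \<noteq> 0}"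
    by (rule rev_finite_subset)
  \<comment> \<open>Reflecting turns the period \<open>s\<close> into \<open>- s\<close>, which is
    again a period of \<open>g\<close>.\<close>
  moreover have "g (2 * p - (x + s)) = g (2 * p - x)" for x
  proof -
    have "g ((2 * p - (x + s)) + s) = g (2 * p - (x + s))"
      using g(1) unfolding translation_invariant_def by blast
    then show ?thesis by simp
  qed
  then have "translation_invariant (\<lambda>x. h (2 * p - x) - h x) s"
    using g(1) unfolding diff translation_invariant_def by simp
  ultimately have "h (2 * p - x) - h x = 0" for x
    using finite_support_translation_invariant[OF _ _ g(2)] by fastforce
  with nosym[of p] show False
    by (simp add: mirror_invariant_def)
qed

lemma not_mirror_invariant_three_deltas:
  assumes "\<not> progression3 a b c" and "a \<noteq> b" "a \<noteq> c" "b \<noteq> c"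
  shows "\<not> mirror_invariant (\<lambda>x. delta a x + delta b x + delta c x) p"
proof
  assume *: "mirror_invariant (\<lambda>x. delta a x + delta b x + delta c x) p"
  have "2 * p - a \<in> {a, b, c}" "2 * p - b \<in> {a, b, c}" "2 * p - c \<in> {a, b, c}"
    using *[unfolded mirror_invariant_def, rule_format, of a]
      *[unfolded mirror_invariant_def, rule_format, of b]
      *[unfolded mirror_invariant_def, rule_format, of c] assms
    by (auto simp: delta_def split: if_splits)
  then show False
    using assms by (auto simp: progression3_def)
qed

lemma finite_support_three_deltas: "finite {x. delta a x + delta b x + delta c x \<noteq> 0}"
  by (rule finite_subset[of _ "{a, b, c}"]) (auto simp: delta_def)

lemma asymmetric_periodic_plus_three_deltas:
  assumes "translation_invariant g s" "s \<noteq> 0"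
    and "\<not> progression3 a b c" "a \<noteq> b" "a \<noteq> c" "b \<noteq> c"
  shows "asymmetric (\<lambda>x. g x + delta a x + delta b x + delta c x)"
  using asymmetric_periodic_plus_finite[OF assms(1,2) finite_support_three_deltas
      not_mirror_invariant_three_deltas[OF assms(3-6)]]
  by (simp add: add.assoc)

text \<open>A mirror of the perturbation would fix both \<open>a\<close>, its only point of value
  -1, and \<open>b\<close>, its only point of value 1, but a mirror fixes one point only.\<close>

lemma asymmetric_periodic_plus_delta_minus_delta:
  assumes "translation_invariant g s" "s \<noteq> 0" and "a \<noteq> b"
  shows "asymmetric (\<lambda>x. g x - delta a x + delta b x)"
proof -
  have "finite {x. delta b x - delta a x \<noteq> 0}"
    by (rule finite_subset[of _ "{a, b}"]) (auto simp: delta_def)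
  moreover have "\<not> mirror_invariant (\<lambda>x. delta b x - delta a x) p" for p
  proof
    assume *: "mirror_invariant (\<lambda>x. delta b x - delta a x) p"
    have "2 * p - a = a" "2 * p - b = b"
      using *[unfolded mirror_invariant_def, rule_format, of a]
        *[unfolded mirror_invariant_def, rule_format, of b] \<open>a \<noteq> b\<close>
      by (auto simp: delta_def split: if_splits)
    with \<open>a \<noteq> b\<close> show False by simp
  qed
  ultimately have "asymmetric (\<lambda>x. g x + (delta b x - delta a x))"
    by (rule asymmetric_periodic_plus_finite[OF assms(1,2)])
  then show ?thesis
    by (simp add: algebra_simps)
qed

text \<open>With \<open>p\<close> as origin, two points form a progression with \<open>p\<close> iff
  their quotient is -1, 2 or 1/2. The quotient of two different numbers from this list is not in the
  list, so the three pairs cannot all qualify.\<close>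

lemma exists_not_progression3:
  assumes "distinct [p, u, v, w]"
  obtains a b where "a \<in> {u, v, w}" "b \<in> {u, v, w}" "a \<noteq> b" "\<not> progression3 p a b"
proof -
  have "\<not> progression3 p u v \<or> \<not> progression3 p u w \<or> \<not> progression3 p v w"
    using assms unfolding progression3_def by auto
  then show thesis
    using assms that by auto
qed

section \<open>Difference equations from pairs of mirrors\<close>

lemma two_mirrors_difference:
  assumes "mirror_invariant f p" and "mirror_invariant (\<lambda>x. f x + delta w x) q"
  shows "f (x + 2 * (p - q)) - f x = delta w x - delta (2 * q - w) x"
proof -
  have "f (x + 2 * (p - q)) = f (2 * q - x)"
    using assms(1)[unfolded mirror_invariant_def, rule_format, of "2 * q - x"]
    by (simp add: algebra_simps)
  moreover have "f (2 * q - x) + delta w (2 * q - x) = f x + delta w x"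
    using assms(2) by (simp add: mirror_invariant_def)
  moreover have "delta w (2 * q - x) = delta (2 * q - w) x"
    by (auto simp: delta_def)
  ultimately show ?thesis by linarith
qed

text \<open>Evaluating \<open>f (x + t + t')\<close> along both orders of the two shifts gives an
  identity between eight deltas, which is then read off at two points.\<close>

lemma commuting_differences:
  fixes f :: "real \<Rightarrow> int"
  assumes f: "\<And>x. f (x + t) - f x = delta w x - delta a x"
    and f': "\<And>x. f (x + t') - f x = delta w' x - delta a' x"
    and a: "a = 2 * p - w - t" and a': "a' = 2 * p - w' - t'"
    and ne: "t \<noteq> 0" "t' \<noteq> 0" "w \<noteq> a" "w' \<noteq> a'" "w \<noteq> w'" and not_mirror: "w + w' \<noteq> 2 * p"
  shows "t = p - w \<and> a = p"
proof -
  have comm: "delta w (x + t') - delta a (x + t') - delta w x + delta a x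
      = delta w' (x + t) - delta a' (x + t) - delta w' x + delta a' x" for x
    using f[of x] f'[of x] f[of "x + t'"] f'[of "x + t"] by (simp add: add_ac)
  \<comment> \<open>At \<open>x = w\<close> the left side is negative; on the right only
    \<open>- delta a' (w + t)\<close> can be.\<close>
  have 1: "a' = w + t"
    using comm[of w] ne by (auto simp: delta_def split: if_splits)
  then have 2: "a = w' + t'"
    using a a' by simp
  \<comment> \<open>At \<open>x = a\<close> the left side is positive, so one of the two positive
    deltas on the right is 1. Since \<open>a + a' = 2 * p\<close>, the first case gives
    \<open>a = p\<close>; the second gives \<open>w + w' = 2 * p\<close>, which is excluded.\<close>
  have "a = a' \<or> a = w' - t"
    using comm[of a] 1 2 ne by (auto simp: delta_def split: if_splits)
  then show ?thesis
    using 1 2 a a' not_mirror by auto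
qed

section \<open>Breaking all symmetries with four free points\<close>

lemma exists_asymmetric_extension:
  fixes f :: "real \<Rightarrow> int"
  assumes "card W = 4"
  shows "\<exists>A \<subseteq> W. asymmetric (\<lambda>x. f x + (if x \<in> A then 1 else 0))"
proof (rule ccontr)
  assume contra: "\<not> ?thesis"
  have sym: "\<not> asymmetric g"
    if "A \<subseteq> W" "g = (\<lambda>x. f x + (if x \<in> A then 1 else 0))" for A g
    using contra that by blast
  have sym0: "\<not> asymmetric f"
    by (rule sym[of "{}"]) auto
  have sym1: "\<not> asymmetric (\<lambda>x. f x + delta w x)" if "w \<in> W" for w
    by (rule sym[of "{w}"]) (use that in \<open>auto simp: delta_def\<close>)
  have sym2: "\<not> asymmetric (\<lambda>x. f x + delta v x + delta w x)"
    if "v \<in> W" "w \<in> W" "v \<noteq> w" for v w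
    by (rule sym[of "{v, w}"]) (use that in \<open>auto simp: delta_def fun_eq_iff\<close>)
  have sym3: "\<not> asymmetric (\<lambda>x. f x + delta u x + delta v x + delta w x)"
    if "u \<in> W" "v \<in> W" "w \<in> W" "u \<noteq> v" "u \<noteq> w" "v \<noteq> w" for u v w
    by (rule sym[of "{u, v, w}"]) (use that in \<open>auto simp: delta_def fun_eq_iff\<close>)
  obtain w1 w2 w3 w4 where W: "W = {w1, w2, w3, w4}" and dist: "distinct [w1, w2, w3, w4]"
    using assms by (auto simp: card_Suc_eq numeral_eq_Suc)

  have nonper: "s = 0" if s: "translation_invariant f s" for s
  proof (rule ccontr)
    assume "s \<noteq> 0"
    obtain a b where ab: "a \<in> {w2, w3, w4}" "b \<in> {w2, w3, w4}" "a \<noteq> b" "\<not> progression3 w1 a b"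
      using exists_not_progression3[OF dist] .
    then have "w1 \<noteq> a" "w1 \<noteq> b" "w1 \<in> W" "a \<in> W" "b \<in> W"
      using dist W by auto
    with ab show False
      using asymmetric_periodic_plus_three_deltas[OF s \<open>s \<noteq> 0\<close>] sym3 by blast
  qed
  have nonper1: "s = 0" if w: "w \<in> W" and s: "translation_invariant (\<lambda>x. f x + delta w x) s" for w s
  proof (rule ccontr)
    assume "s \<noteq> 0"
    obtain v where v: "v \<in> W" "w \<noteq> v"
      using W dist by auto
    \<comment> \<open>\<open>f + delta v\<close> arises from the periodic \<open>f + delta w\<close>
      by moving the unit from \<open>w\<close> to \<open>v\<close>.\<close>
    from asymmetric_periodic_plus_delta_minus_delta[OF s \<open>s \<noteq> 0\<close> v(2)] sym1[OF v(1)]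
    show False by simp
  qed
  obtain p where p: "mirror_invariant f p"
    using sym0 nonper by (auto simp: asymmetric_def)
  have step: "\<exists>t a. t \<noteq> 0 \<and> w \<noteq> a \<and> a = 2 * p - w - t \<and>
      (\<forall>x. f (x + t) - f x = delta w x - delta a x)" if w: "w \<in> W" "w \<noteq> p" for w
  proof -
    obtain q where q: "mirror_invariant (\<lambda>x. f x + delta w x) q"
      using sym1[OF w(1)] nonper1[OF w(1)] unfolding asymmetric_def by blast
    note diff = two_mirrors_difference[OF p q]
    \<comment> \<open>If \<open>p = q\<close>, the difference at \<open>w\<close> is 0, so
      \<open>w\<close> is its own mirror image and equals \<open>p\<close>.\<close>
    have "p \<noteq> q"
      using diff[of w] w by (auto simp: delta_def split: if_splits)
    moreover have "w \<noteq> 2 * q - w"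
    proof
      assume "w = 2 * q - w"
      then have "translation_invariant f (2 * (p - q))"
        using diff unfolding translation_invariant_def by simp
      with nonper \<open>p \<noteq> q\<close> show False by fastforce
    qed
    ultimately show ?thesis
      using diff by (intro exI[of _ "2 * (p - q)"] exI[of _ "2 * q - w"]) auto
  qed
  obtain u v w where uvw: "u \<in> W" "v \<in> W" "w \<in> W" "distinct [p, u, v, w]"
  proof (cases "p \<in> {w1, w2, w3}")
    case True
    then show thesis using that[of w4 "if p = w1 then w2 else w1" "if p = w3 then w2 else w3"] W dist
      by auto
  next
    case False
    then show thesis using that[of w1 w2 w3] W dist by auto
  qed
  \<comment> \<open>\<open>u\<close> has only one mirror image about \<open>p\<close>, so
    \<open>v\<close> and \<open>w\<close> cannot both be it.\<close>
  obtain y z where yz: "y \<in> {u, v, w}" "z \<in> {u, v, w}" "y \<noteq> z" "y + z \<noteq> 2 * p"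
  proof (cases "u + v = 2 * p")
    case True
    with uvw(4) show thesis by (intro that[of u w]) auto
  next
    case False
    with uvw(4) show thesis by (intro that[of u v]) auto
  qed
  then have yz': "y \<in> W" "y \<noteq> p" "z \<in> W" "z \<noteq> p"
    using uvw by auto
  obtain t a where t: "t \<noteq> 0" "y \<noteq> a" "a = 2 * p - y - t"
    "\<And>x. f (x + t) - f x = delta y x - delta a x"
    using step[OF yz'(1,2)] by auto
  obtain t' a' where t': "t' \<noteq> 0" "z \<noteq> a'" "a' = 2 * p - z - t'"
    "\<And>x. f (x + t') - f x = delta z x - delta a' x"
    using step[OF yz'(3,4)] by auto
  have ta: "t = p - y" "a = p"
    using commuting_differences[OF t(4) t'(4) t(3) t'(3) t(1) t'(1) t(2) t'(2) yz(3,4)] by auto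
  \<comment> \<open>The shift by \<open>t = p - y\<close> carries \<open>y\<close> to
    \<open>p\<close>, so subtracting \<open>delta p\<close> absorbs the jump
    \<open>delta y - delta p\<close> of \<open>f\<close>.\<close>
  have per: "translation_invariant (\<lambda>x. f x - delta p x) t"
    unfolding translation_invariant_def
  proof
    fix x
    have "delta p (x + t) = delta y x"
      using ta by (auto simp: delta_def)
    with t(4)[of x] ta show "f (x + t) - delta p (x + t) = f x - delta p x" by simp
  qed
  obtain b c where bc: "b \<in> {u, v, w}" "c \<in> {u, v, w}" "b \<noteq> c" "\<not> progression3 p b c"
    using exists_not_progression3[OF uvw(4)] .
  then have bc': "b \<in> W" "c \<in> W" "p \<noteq> b" "p \<noteq> c"
    using uvw by auto
  \<comment> \<open>Relative to the periodic \<open>f - delta p\<close>, this adds the three deltas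
    at \<open>p\<close>, \<open>b\<close> and \<open>c\<close>.\<close>
  have "asymmetric (\<lambda>x. f x + delta b x + delta c x)"
    using asymmetric_periodic_plus_three_deltas[OF per t(1) bc(4) bc'(3,4) bc(3)] by simp
  with sym2[OF bc'(1,2) bc(3)] show False by simp
qed

section \<open>Two-colourings and the distinguishing number\<close>

lemma asymmetric_comp_int: "asymmetric (\<lambda>x. int (c x)) \<longleftrightarrow> asymmetric c"
  by (simp add: asymmetric_def translation_invariant_def mirror_invariant_def)

text \<open>Four points \<open>V\<close> of \<open>W\<close> are chosen and all of \<open>W\<close>
  starts with colour 1; raising the points of some \<open>A \<subseteq> V\<close> to colour 2 breaks
  every symmetry. This treats infinite \<open>W\<close> as well.\<close>

lemma extends_to_asymmetric:
  fixes W :: "real set"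
  assumes W: "infinite W \<or> 4 \<le> card W" and c: "c \<in> (UNIV - W) \<rightarrow> {1..2::nat}"
  obtains c' where "c' \<in> UNIV \<rightarrow> {1..2::nat}" "\<forall>x \<in> UNIV - W. c' x = c x" "asymmetric c'"
proof -
  obtain V where V: "V \<subseteq> W" "card V = 4"
    using W infinite_arbitrarily_large obtain_subset_with_card_n by metis
  define f where "f x = (if x \<in> W then 1 else c x)" for x
  obtain A where A: "A \<subseteq> V" "asymmetric (\<lambda>x. int (f x) + (if x \<in> A then 1 else 0))"
    using exists_asymmetric_extension[OF V(2), of "\<lambda>x. int (f x)"] by blast
  define c' where "c' x = f x + (if x \<in> A then 1 else 0)" for x
  have "(\<lambda>x. int (c' x)) = (\<lambda>x. int (f x) + (if x \<in> A then 1 else 0))"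
    by (auto simp: c'_def)
  then have "asymmetric c'"
    using A(2) asymmetric_comp_int by metis
  moreover have "c' x \<in> {1..2}" for x
    using A(1) V(1) funcset_mem[OF c, of x] by (cases "x \<in> W") (auto simp: c'_def f_def)
  moreover have "\<forall>x \<in> UNIV - W. c' x = c x"
    using A(1) V(1) by (auto simp: c'_def f_def)
  ultimately show thesis
    using that by blast
qed

lemma distinguishing_number_Aut_real: "distinguishing_number Aut_real UNIV (\<lambda>f. f) = 2"
  unfolding distinguishing_number_def distinguishing_Aut_real_iff
proof (rule Least_equality)
  have "infinite (UNIV :: real set)"
    by (rule infinite_UNIV_char_0)
  then show "\<exists>c \<in> UNIV \<rightarrow> {1..2}. asymmetric (c :: real \<Rightarrow> nat)"
    using extends_to_asymmetric[of UNIV "\<lambda>_. 1"] by blast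
next
  fix k assume "\<exists>c \<in> UNIV \<rightarrow> {1..k}. asymmetric (c :: real \<Rightarrow> nat)"
  then obtain c :: "real \<Rightarrow> nat" where c: "c \<in> UNIV \<rightarrow> {1..k}" "asymmetric c"
    by blast
  show "2 \<le> k"
  proof (rule ccontr)
    \<comment> \<open>For \<open>k = 0\<close> no colouring exists, and for \<open>k = 1\<close> it
      is constant.\<close>
    assume "\<not> 2 \<le> k"
    with c(1) have "c x = 1" for x
      by (fastforce dest: funcset_mem[of _ _ _ x])
    then have "mirror_invariant c 0"
      by (simp add: mirror_invariant_def)
    with c(2) show False
      by (simp add: asymmetric_def)
  qed
qed

section \<open>Three free points do not suffice\<close>

text \<open>The points of colour 2 form a subset of \<open>{0, 1, 2}\<close>. It is symmetric about
  1/2 for \<open>{0, 1}\<close>, 3/2 for \<open>{1, 2}\<close>, 0 for \<open>{0}\<close>, 2 for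
  \<open>{2}\<close>, and about 1 otherwise.\<close>

lemma constant_off_012_not_asymmetric:
  fixes c :: "real \<Rightarrow> nat"
  assumes c: "c \<in> UNIV \<rightarrow> {1..2}" and const: "\<And>x. x \<notin> {0, 1, 2} \<Longrightarrow> c x = 1"
  shows "\<not> asymmetric c"
proof -
  \<comment> \<open>Off \<open>{0, 1, 2}\<close> and its image under
    \<open>x \<mapsto> m - x\<close>, both \<open>x\<close> and \<open>m - x\<close> have colour 1,
    so finitely many points remain to be checked.\<close>
  have mirror: "mirror_invariant c (m / 2)"
    if "\<And>x. x \<in> {0, 1, 2} \<union> {m, m - 1, m - 2} \<Longrightarrow> c (m - x) = c x" for m
    unfolding mirror_invariant_def
  proof
    fix x
    show "c (2 * (m / 2) - x) = c x"
    proof (cases "x \<in> {0, 1, 2} \<union> {m, m - 1, m - 2}")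
      case False
      then have "x \<notin> {0, 1, 2}" "m - x \<notin> {0, 1, 2}"
        by (auto simp: algebra_simps)
      then show ?thesis using const by simp
    qed (use that in simp)
  qed
  have vals: "c x = 1 \<or> c x = 2" for x
    using funcset_mem[OF c, of x] by auto
  have out: "c (- 2) = 1" "c (- 1) = 1" "c 3 = 1" "c 4 = 1"
    by (rule const, simp)+
  consider "c 0 = c 2" | "c 0 = c 1" "c 2 = 1" | "c 1 = c 2" "c 0 = 1"
    | "c 0 = 2" "c 1 = 1" "c 2 = 1" | "c 0 = 1" "c 1 = 1" "c 2 = 2"
    using vals[of 0] vals[of 1] vals[of 2] by fastforce
  then have "\<exists>m. mirror_invariant c (m / 2)"
  proof cases
    case 1
    then show ?thesis by (intro exI[of _ 2] mirror) auto
  next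
    case 2
    then show ?thesis by (intro exI[of _ 1] mirror) (auto simp: out)
  next
    case 3
    then show ?thesis by (intro exI[of _ 3] mirror) (auto simp: out)
  next
    case 4
    then show ?thesis by (intro exI[of _ 0] mirror) (auto simp: out)
  next
    case 5
    then show ?thesis by (intro exI[of _ 4] mirror) (auto simp: out)
  qed
  then show ?thesis
    by (auto simp: asymmetric_def)
qed

theorem theorem2: "ext_D Aut_real (UNIV :: real set) (\<lambda>f. f) = 4"
  unfolding ext_D_def ext_D_k_def distinguishing_number_Aut_real distinguishing_Aut_real_iff
proof (rule Least_equality, goal_cases)
  case 1
  show ?case
  proof (intro allI impI ballI)
    fix W and c :: "real \<Rightarrow> nat"
    assume "fixing_set Aut_real UNIV (\<lambda>f. f) W \<and> (infinite W \<or> 4 \<le> card W)"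
      and c: "c \<in> (UNIV - W) \<rightarrow> {1..2}"
    then have "infinite W \<or> 4 \<le> card W"
      by blast
    from this c obtain c' where "c' \<in> UNIV \<rightarrow> {1..2}" "\<forall>x \<in> UNIV - W. c' x = c x" "asymmetric c'"
      by (rule extends_to_asymmetric)
    then show "\<exists>c' \<in> UNIV \<rightarrow> {1..2}. (\<forall>x \<in> UNIV - W. c' x = c x) \<and> asymmetric c'"
      by blast
  qed
next
  case (2 m)
  show "4 \<le> m"
  proof (rule ccontr)
    assume "\<not> 4 \<le> m"
    \<comment> \<open>For \<open>m \<le> 3\<close> the fixing set \<open>{0, 1, 2}\<close> is large
      enough to be covered by the assumption on \<open>m\<close>.\<close>
    then have "m \<le> card {0, 1, 2 :: real}"
      by simp
    moreover have "fixing_set Aut_real UNIV (\<lambda>f. f) {0, 1, 2 :: real}"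
      by (rule fixing_set_Aut_real[of 0 _ 1]) auto
    moreover have "(\<lambda>_. 1) \<in> (UNIV - {0, 1, 2 :: real}) \<rightarrow> {1..2 :: nat}"
      by auto
    ultimately have "\<exists>c' \<in> UNIV \<rightarrow> {1..2 :: nat}.
        (\<forall>x \<in> UNIV - {0, 1, 2 :: real}. c' x = 1) \<and> asymmetric c'"
      using 2[THEN spec[of _ "{0, 1, 2}"], THEN mp, THEN bspec[of _ _ "\<lambda>_. 1"]] by fast
    then obtain c' :: "real \<Rightarrow> nat" where c': "c' \<in> UNIV \<rightarrow> {1..2}"
      "\<forall>x \<in> UNIV - {0, 1, 2}. c' x = 1" "asymmetric c'"
      by blast
    then have "\<not> asymmetric c'"
      by (intro constant_off_012_not_asymmetric) auto
    with c'(3) show False by contradiction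
  qed
qed

end
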